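(* Let $(X,R)$ be a forcing network and let $T$ be an $X$-colored tree. Then, in the multi-color forcing process with propagation applied to $T$, each propagating forcing step completes in at most $\operatorname{diam}(T)$ forcing steps (counting only forcing steps in which at least one vertex changes color), where $\operatorname{diam}(T)$ is the maximum distance between two vertices of $T$.
   Context: Let $X\subseteq\{1,\dots,N\}$ be a finite set of colors. An $X$-colored graph is a finite simple graph together with an assignment of a color from $X$ to each vertex. A forcing network is a pair $(X,R)$ where $R=(r_1,\dots,r_m)$ is an ordered list of color change rules, each of the form $a\to b$ with $a,b\in X$, $a\neq b$. A forcing step with rule $a\to b$ means: simultaneously recolor with color $a$ every vertex of color $b$ that has at least one neighbor of color $a$. A propagating forcing step with rule $a\to b$ means performing forcing steps with this rule repeatedly until no vertex of color $b$ has a neighbor of color $a$. In the multi-color forcing process with propagation, the rules are applied as propagating forcing steps in the cyclic order $r_1,\dots,r_m,r_1,\dots$, until no rule $a\to b\in R$ has an edge joining a vertex of color $a$ and a vertex of color $b$. *)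

theory Defs
  imports "Graph_Theory.Graph_Theory"
begin

(* A finite simple graph is the locale predicate graph of Graph_Theory.Digraph: a finite,
   loop-free digraph without parallel arcs whose arc relation is symmetric.  An edge uv is a
   pair of opposite arcs, so the library predicates forest and tree would regard u-v-u as a
   cycle; undirected cycles are the directed cycles of length at least 3.  The predicate
   connected requires at least one vertex. *)
definition undirected_tree :: "('v, 'e) pre_digraph \<Rightarrow> bool" where
  "undirected_tree T \<longleftrightarrow>
     graph T \<and> connected T \<and> \<not> (\<exists>p. pre_digraph.cycle T p \<and> 3 \<le> length p)"

(* The distance is the library's shortest-walk cost with every arc of weight 1; it takes values
   in ereal and is finite on connected graphs. *)
definition distance :: "('v, 'e) pre_digraph \<Rightarrow> 'v \<Rightarrow> 'v \<Rightarrow> ereal" where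
  "distance G u v = wf_digraph.\<mu> G (\<lambda>_. 1) u v"

definition diam :: "('v, 'e) pre_digraph \<Rightarrow> ereal" where
  "diam G = Max {distance G u v | u v. u \<in> verts G \<and> v \<in> verts G}"

type_synonym color = nat

(* (a, b) stands for the color change rule a \<rightarrow> b. *)
type_synonym rule = "color \<times> color"

definition forcing_network :: "nat \<Rightarrow> color set \<Rightarrow> rule list \<Rightarrow> bool" where
  "forcing_network N X R \<longleftrightarrow>
     X \<subseteq> {1..N} \<and> (\<forall>(a, b) \<in> set R. a \<in> X \<and> b \<in> X \<and> a \<noteq> b)"

(* Colorings are total functions; only their values on the vertices matter. *)
definition colored_by :: "('v, 'e) pre_digraph \<Rightarrow> color set \<Rightarrow> ('v \<Rightarrow> color) \<Rightarrow> bool" where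
  "colored_by G X c \<longleftrightarrow> c ` verts G \<subseteq> X"

definition forcing_step ::
  "('v, 'e) pre_digraph \<Rightarrow> rule \<Rightarrow> ('v \<Rightarrow> color) \<Rightarrow> ('v \<Rightarrow> color)" where
  "forcing_step G r c =
     (\<lambda>v. if c v = snd r \<and> (\<exists>u. u \<rightarrow>\<^bsub>G\<^esub> v \<and> c u = fst r) then fst r else c v)"

definition applicable ::
  "('v, 'e) pre_digraph \<Rightarrow> rule \<Rightarrow> ('v \<Rightarrow> color) \<Rightarrow> bool" where
  "applicable G r c \<longleftrightarrow> (\<exists>u v. u \<rightarrow>\<^bsub>G\<^esub> v \<and> c u = fst r \<and> c v = snd r)"

(* propagating_step G r c n c': the propagating forcing step with rule r started at c ends
   with c' after n forcing steps.  Since a rule a \<rightarrow> b has a \<noteq> b, a forcing step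
   changes some vertex exactly when the rule is applicable, so n counts precisely the forcing
   steps in which at least one vertex changes color. *)
inductive propagating_step ::
  "('v, 'e) pre_digraph \<Rightarrow> rule \<Rightarrow> ('v \<Rightarrow> color) \<Rightarrow> nat \<Rightarrow> ('v \<Rightarrow> color) \<Rightarrow> bool"
  for G r where
  stop: "\<not> applicable G r c \<Longrightarrow> propagating_step G r c 0 c"
| force: "applicable G r c \<Longrightarrow> propagating_step G r (forcing_step G r c) n c' \<Longrightarrow>
    propagating_step G r c (Suc n) c'"

definition process_finished ::
  "('v, 'e) pre_digraph \<Rightarrow> rule list \<Rightarrow> ('v \<Rightarrow> color) \<Rightarrow> bool" where
  "process_finished G R c \<longleftrightarrow> (\<forall>r \<in> set R. \<not> applicable G r c)"

(* The rule used in the i-th propagating step, counting from 0, in the cyclic order of R. *)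
definition rule_at :: "rule list \<Rightarrow> nat \<Rightarrow> rule" where
  "rule_at R i = R ! (i mod length R)"

(* process_state G R c0 i c: the multi-color forcing process with propagation, started at c0,
   performs at least i propagating steps, and c is the coloring after the first i of them. *)
inductive process_state ::
  "('v, 'e) pre_digraph \<Rightarrow> rule list \<Rightarrow> ('v \<Rightarrow> color) \<Rightarrow> nat \<Rightarrow> ('v \<Rightarrow> color) \<Rightarrow> bool"
  for G R c0 where
  start: "process_state G R c0 0 c0"
| propagate: "process_state G R c0 i c \<Longrightarrow> \<not> process_finished G R c \<Longrightarrow>
    propagating_step G (rule_at R i) c n c' \<Longrightarrow> process_state G R c0 (Suc i) c'"

end

theory Submission
  imports Defs
begin

text \<open>
  If a vertex is recolored in the \<open>n\<close>-th forcing step of a propagating step with rule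
  \<open>a \<rightarrow> b\<close>, tracing back which neighbor forced it gives a path with \<open>n\<close> edges that starts in
  color \<open>a\<close> and has color \<open>b\<close> everywhere else; no vertex repeats, because the path is colored
  \<open>a, b, \<dots>, b\<close> before the first step, \<open>\<cdot>, a, b, \<dots>, b\<close> after it, and so on.  In a tree, a path
  is the only path between its ends, hence a shortest walk, so \<open>n\<close> is a distance.
\<close>

text \<open>A path from \<open>x\<close> to \<open>y\<close> avoiding \<open>u\<close>, closed up
  through \<open>u\<close>, is a cycle. Since \<open>x \<noteq> y\<close> the path has an arc, so
  the cycle is not merely an edge walked back and forth.\<close>

lemma (in graph) two_arcs_reachable_imp_cycle:
  assumes e: "e \<in> arcs G" "tail G e = u" "head G e = x"
    and f: "f \<in> arcs G" "tail G f = u" "head G f = y"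
    and "x \<noteq> y" and reach: "x \<rightarrow>\<^sup>*\<^bsub>G \<restriction> (verts G - {u})\<^esub> y"
  obtains p where "cycle p" "3 \<le> length p"
proof -
  let ?H = "G \<restriction> (verts G - {u})"
  interpret H: wf_digraph ?H by auto
  obtain q where q: "H.apath x q y"
    using reach unfolding H.reachable_apath by blast
  have "u \<notin> set (awalk_verts x q)"
    using q unfolding H.apath_def H.awalk_conv awalk_verts_induce by auto
  moreover have "apath x q y"
    using q by (rule subgraph_apath_imp_apath) (auto intro: subgraph_induce_subgraphI)
  then have xq: "awalk x q y" "distinct (awalk_verts x q)" and last: "awlast x q = y"
    by (auto simp: apath_def)
  \<comment> \<open>\<open>g\<close> is \<open>f\<close> reversed: the cycle leaves \<open>u\<close>
    along \<open>e\<close> and returns along \<open>g\<close>.\<close>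
  moreover obtain g where g: "g \<in> arcs G" "tail G g = y" "head G g = u"
    using sym_arcs f unfolding symmetric_conv by metis
  moreover have "awalk x (q @ [g]) u"
    using xq g last by (auto simp: awalk_simps)
  ultimately have "awalk u (e # q @ [g]) u" "distinct (tl (awalk_verts u (e # q @ [g])))"
    using e by (auto simp: awalk_Cons_iff awalk_verts_append simp del: awalk_append_iff)
  moreover have "3 \<le> length (e # q @ [g])"
    using xq \<open>x \<noteq> y\<close> by (cases q) (auto simp: awalk_Nil_iff)
  ultimately show thesis
    by (intro that[of "e # q @ [g]"]) (auto simp: cycle_def)
qed

text \<open>If the two paths left \<open>u\<close> towards different vertices, both of these would
  reach \<open>v\<close> while avoiding \<open>u\<close>, hence by symmetry reach each other, and a
  cycle through \<open>u\<close> would arise. Equal heads give equal arcs, as there are no parallel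
  ones.\<close>

lemma (in graph) unique_apath:
  assumes acyclic: "\<not> (\<exists>p. cycle p \<and> 3 \<le> length p)"
    and "apath u p v" "apath u q v"
  shows "p = q"
  using assms(2,3)
proof (induction p arbitrary: u q)
  case Nil
  then show ?case
    using apath_nonempty_ends[of u q v] by (auto simp: apath_Nil_iff)
next
  case (Cons e p)
  from Cons.prems have "u \<noteq> v"
    using apath_nonempty_ends by blast
  with Cons.prems obtain f q' where q: "q = f # q'"
    by (cases q) (auto simp: apath_Nil_iff)
  let ?S = "verts G - {u}"
  interpret S: wf_digraph "G \<restriction> ?S" by auto
  have e: "e \<in> arcs G" "tail G e = u" "apath (head G e) p v" "u \<notin> set (awalk_verts (head G e) p)"
    using Cons.prems by (auto simp: apath_Cons_iff)
  have f: "f \<in> arcs G" "tail G f = u" "apath (head G f) q' v" "u \<notin> set (awalk_verts (head G f) q')"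
    using Cons.prems q by (auto simp: apath_Cons_iff)
  have "S.awalk (head G e) p v" "S.awalk (head G f) q' v"
    using e f by (auto simp: apath_def intro!: awalk_induce)
  then have "head G e \<rightarrow>\<^sup>*\<^bsub>G \<restriction> ?S\<^esub> v" "head G f \<rightarrow>\<^sup>*\<^bsub>G \<restriction> ?S\<^esub> v"
    by (auto intro: S.reachable_awalkI)
  moreover have "symmetric (G \<restriction> ?S)"
    using sym_arcs by (rule induced_graph_imp_symmetric) auto
  ultimately have "head G e \<rightarrow>\<^sup>*\<^bsub>G \<restriction> ?S\<^esub> head G f"
    using symmetric_reachable S.reachable_trans by metis
  with acyclic e f have "head G e = head G f"
    using two_arcs_reachable_imp_cycle by metis
  with e f have "e = f"
    by (intro no_multi_arcs) (auto simp: arc_to_ends_def)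
  with Cons.IH e f q show ?case by auto
qed

text \<open>Cutting the closed parts out of any walk from \<open>u\<close> to \<open>v\<close>
  leaves a path, which is \<open>p\<close> by uniqueness; with unit weights this never raises the
  cost.\<close>

lemma apath_length_le_distance:
  assumes "undirected_tree G" "pre_digraph.apath G u p v"
  shows "ereal (real (length p)) \<le> distance G u v"
proof -
  interpret graph G using assms(1) by (simp add: undirected_tree_def)
  show ?thesis
    unfolding distance_def \<mu>_def
  proof (rule INF_greatest)
    fix q assume "q \<in> {q. awalk u q v}"
    then have q: "awalk u q v" by simp
    have "p = awalk_to_apath q"
      using assms(1) unfolding undirected_tree_def
      by (intro unique_apath[OF _ assms(2) apath_awalk_to_apath[OF q]]) blast
    moreover have "awalk_cost (\<lambda>_. 1) (awalk_to_apath q) \<le> awalk_cost (\<lambda>_. 1) q"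
      using q by (rule awalk_to_path_no_neg_cyc_cost)
        (auto dest!: pos_cost_pos_awalk_cost[where c="\<lambda>_. 1"])
    ultimately show "ereal (real (length p)) \<le> ereal (awalk_cost (\<lambda>_. 1) q)"
      by (simp add: awalk_cost_def sum_list_triv)
  qed
qed

lemma apath_length_le_diam:
  assumes "undirected_tree G" "pre_digraph.apath G u p v"
  shows "ereal (real (length p)) \<le> diam G"
proof -
  interpret graph G using assms(1) by (simp add: undirected_tree_def)
  have "u \<in> verts G" "v \<in> verts G"
    using assms(2) by (auto simp: apath_def dest: awalk_hd_in_verts awalk_last_in_verts)
  \<comment> \<open>Written as an image of a finite set, the set of distances is finite, as
    \<open>Max_ge\<close> needs.\<close>
  moreover have "{distance G u v | u v. u \<in> verts G \<and> v \<in> verts G}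
      = (\<lambda>(u, v). distance G u v) ` (verts G \<times> verts G)"
    by auto
  ultimately have "distance G u v \<le> diam G"
    unfolding diam_def by (intro Max_ge) auto
  with apath_length_le_distance[OF assms] show ?thesis by simp
qed

text \<open>Induction on the steps: the path found for the coloring after the first step is
  prolonged at its front. If that step is the only one, a single edge serves.\<close>

lemma propagating_step_apath:
  assumes "wf_digraph G" "fst r \<noteq> snd r" "propagating_step G r c n c'" "0 < n"
  shows "\<exists>u p v. pre_digraph.apath G u p v \<and> length p = n \<and> c u = fst r \<and>
    (\<forall>w \<in> set (tl (pre_digraph.awalk_verts G u p)). c w = snd r)"
  using assms(3,4)
proof (induction rule: propagating_step.induct)
  case (stop c)
  then show ?case by simp
next
  case (force c n c')
  interpret wf_digraph G by fact
  let ?F = "forcing_step G r c"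
  have extend: "\<exists>u p v. apath u p v \<and> length p = Suc (length q) \<and> c u = fst r \<and>
      (\<forall>w \<in> set (tl (awalk_verts u p)). c w = snd r)"
    if q: "apath x q v" "u \<rightarrow>\<^bsub>G\<^esub> x" "c u = fst r" "\<forall>w \<in> set (awalk_verts x q). c w = snd r"
    for u x q v
  proof -
    obtain e where e: "e \<in> arcs G" "tail G e = u" "head G e = x"
      using q(2) by auto
    \<comment> \<open>The colors differ: \<open>fst r\<close> at \<open>u\<close>,
      \<open>snd r\<close> along \<open>q\<close>.\<close>
    moreover have "u \<notin> set (awalk_verts x q)"
      using q assms(2) by auto
    ultimately have "apath u (e # q) v"
      using q(1) by (simp add: apath_Cons_iff)
    then show ?thesis
      using q e by (intro exI[of _ u] exI[of _ "e # q"] exI[of _ v]) auto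
  qed
  show ?case
  proof (cases "n = 0")
    case True
    obtain u x where "u \<rightarrow>\<^bsub>G\<^esub> x" "c u = fst r" "c x = snd r"
      using force.hyps by (auto simp: applicable_def)
    moreover from this have "apath x [] x"
      by (auto simp: apath_Nil_iff dest: adj_in_verts)
    ultimately show ?thesis
      using extend[of x "[]" x u] True by auto
  next
    case False
    then obtain x q v where q: "apath x q v" "length q = n" "?F x = fst r"
        "\<forall>w \<in> set (tl (awalk_verts x q)). ?F w = snd r"
      using force.IH by auto
    have F_b: "c w = snd r \<and> \<not> (\<exists>u. u \<rightarrow>\<^bsub>G\<^esub> w \<and> c u = fst r)" if "?F w = snd r" for w
      using that assms(2) by (auto simp: forcing_step_def split: if_splits)
    obtain f q' where f: "q = f # q'"
      using q False by (cases q) auto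
    \<comment> \<open>The second vertex of \<open>q\<close> keeps color \<open>snd r\<close> in this
      step, so its neighbor \<open>x\<close> did not yet have color \<open>fst r\<close>. Thus
      \<open>x\<close> is recolored in this very step, by some \<open>u\<close>.\<close>
    have "x \<rightarrow>\<^bsub>G\<^esub> head G f" "head G f \<in> set (tl (awalk_verts x q))"
      using q(1) hd_in_awalk_verts(2) unfolding f by (auto simp: apath_Cons_iff arcs_ends_conv)
    with q(4) F_b have "c x \<noteq> fst r" by blast
    with q(3) obtain u where "u \<rightarrow>\<^bsub>G\<^esub> x" "c u = fst r" "c x = snd r"
      by (auto simp: forcing_step_def split: if_splits)
    moreover have "\<forall>w \<in> set (awalk_verts x q). c w = snd r"
      using q(1,4) F_b \<open>c x = snd r\<close> unfolding f by (auto simp: apath_Cons_iff)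
    ultimately show ?thesis
      using extend[OF q(1)] q(2) by auto
  qed
qed

text \<open>Each step with an applicable rule strictly shrinks the finite set of vertices of color
  \<open>snd r\<close>.\<close>

lemma propagating_step_terminates:
  assumes "fin_digraph G" "fst r \<noteq> snd r"
  shows "\<exists>n c'. propagating_step G r c n c'"
proof (induction "card {v \<in> verts G. c v = snd r}" arbitrary: c rule: less_induct)
  case less
  interpret fin_digraph G by fact
  show ?case
  proof (cases "applicable G r c")
    case False
    then show ?thesis by (blast intro: propagating_step.stop)
  next
    case True
    let ?F = "forcing_step G r c"
    obtain u v where uv: "u \<rightarrow>\<^bsub>G\<^esub> v" "c u = fst r" "c v = snd r"
      using True by (auto simp: applicable_def)
    then have "v \<in> {v \<in> verts G. c v = snd r} - {v \<in> verts G. ?F v = snd r}"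
      using assms(2) by (auto simp: forcing_step_def dest: adj_in_verts)
    moreover have "{v \<in> verts G. ?F v = snd r} \<subseteq> {v \<in> verts G. c v = snd r}"
      using assms(2) by (auto simp: forcing_step_def split: if_splits)
    ultimately have "card {v \<in> verts G. ?F v = snd r} < card {v \<in> verts G. c v = snd r}"
      by (intro psubset_card_mono) auto
    then show ?thesis
      using less True by (blast intro: propagating_step.force)
  qed
qed

theorem theorem3p4:
  fixes N :: nat and X :: "color set" and R :: "rule list"
    and T :: "('v, 'e) pre_digraph" and c0 c :: "'v \<Rightarrow> color" and i :: nat
  assumes "forcing_network N X R"
    and "undirected_tree T"
    and "colored_by T X c0"
    and "process_state T R c0 i c"
    and "\<not> process_finished T R c"
  shows "(\<exists>n c'. propagating_step T (rule_at R i) c n c') \<and>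
    (\<forall>n c'. propagating_step T (rule_at R i) c n c' \<longrightarrow> ereal (real n) \<le> diam T)"
proof -
  interpret graph T using assms(2) by (simp add: undirected_tree_def)
  have "R \<noteq> []"
    using assms(5) by (auto simp: process_finished_def)
  then have "rule_at R i \<in> set R"
    by (simp add: rule_at_def)
  then have r: "fst (rule_at R i) \<noteq> snd (rule_at R i)"
    using assms(1) by (auto simp: forcing_network_def)
  have "ereal (real n) \<le> diam T" if step: "propagating_step T (rule_at R i) c n c'" for n c'
  proof (cases "n = 0")
    case True
    \<comment> \<open>Connectedness provides a vertex, whose empty path shows that
      \<open>diam T\<close> is nonnegative.\<close>
    obtain u where "u \<in> verts T"
      using assms(2) by (auto simp: undirected_tree_def connected_def strongly_connected_def)
    then have "apath u [] u"
      by (simp add: apath_Nil_iff)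
    from apath_length_le_diam[OF assms(2) this] True show ?thesis by simp
  next
    case False
    then obtain u p v where "apath u p v" "length p = n"
      using propagating_step_apath[OF wf_digraph r step] by auto
    with apath_length_le_diam[OF assms(2)] show ?thesis by blast
  qed
  with propagating_step_terminates[OF fin_digraph r] show ?thesis by blast
qed

end
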